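(* Let $W$ be a graded CLSAS on $\mathcal{W}$. There exists a bilinear form $\phi:W\times W\to\mathbb{C}$ satisfying (i) $\phi(xy,z)-\phi(x,yz)=\phi(yx,z)-\phi(y,xz)$ for all $x,y,z\in W$, and (ii) $\phi(L_a,L_b)-\phi(L_b,L_a)=\frac{1}{12}(b^3-b)\delta_{a+b,0}$ for all $a,b\in G$ (i.e. the central extension $\hat W=W\oplus\mathbb{C}K$ with product $(x+sK)\ast(y+tK)=xy+\phi(x,y)K$ is a left-symmetric algebra whose sub-adjacent Lie algebra is the high rank Virasoro algebra $\mathcal{V}$), if and only if $W=V_{0,\theta}$ for some $\theta\in\mathbb{C}$ with $\theta\neq0$ and $\theta^{-1}\notin G$. In that case $\phi$ is uniquely determined and given by $$\phi(L_a,L_b)=\frac{1}{24}\big(b^3-b-(\theta-\theta^{-1})b^2\big)\delta_{a+b,0}\qquad(a,b\in G).$$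
   Context: $G$ is a free (additive) subgroup of $\mathbb{C}$ of rank $\nu>1$. The high rank Witt algebra $\mathcal{W}$ has basis $\{L_a\mid a\in G\}$ and bracket $[L_a,L_b]=(b-a)L_{a+b}$; the high rank Virasoro algebra $\mathcal{V}$ has basis $\{L_a\mid a\in G\}\cup\{K\}$, $K$ central, and $[L_a,L_b]=(b-a)L_{a+b}+\frac{K}{12}(b^3-b)\delta_{a+b,0}$. A left-symmetric algebra is a complex vector space with bilinear product satisfying $(xy)z-x(yz)=(yx)z-y(xz)$; a compatible left-symmetric algebraic structure (CLSAS) on a Lie algebra $\mathfrak g$ is such a product on $\mathfrak g$ with $xy-yx=[x,y]$. A CLSAS on $\mathcal{W}$ is graded if $L_aL_b=f(a,b)L_{a+b}$ for some function $f:G\times G\to\mathbb{C}$. For $\alpha,\theta\in\mathbb{C}$ with $\theta=0$ or $\theta^{-1}\notin G$, $V_{\alpha,\theta}$ is the graded CLSAS with $L_bL_c=\frac{(\alpha+c+\alpha\theta b)(1+\theta c)}{1+\theta(b+c)}L_{b+c}$; thus $V_{0,\theta}$ has $L_bL_c=\frac{c(1+\theta c)}{1+\theta(b+c)}L_{b+c}$. *)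

theory Defs
  imports Complex_Main
begin

definition free_subgroup_rank :: "complex set \<Rightarrow> nat \<Rightarrow> bool" where
  "free_subgroup_rank G \<nu> \<longleftrightarrow>
     (\<exists>e :: nat \<Rightarrow> complex.
        (\<forall>k :: nat \<Rightarrow> int. (\<Sum>i<\<nu>. of_int (k i) * e i) = 0 \<longrightarrow> (\<forall>i<\<nu>. k i = 0)) \<and>
        G = {(\<Sum>i<\<nu>. of_int (k i) * e i) | k :: nat \<Rightarrow> int. True})"

definition kdelta :: "complex \<Rightarrow> complex \<Rightarrow> complex" where
  "kdelta x y = (if x = y then 1 else 0)"

text \<open>A graded compatible left-symmetric algebraic structure on the Witt algebra
  with basis L_a (a in G) and bracket [L_a,L_b] = (b-a) L_(a+b), given by the
  product L_a L_b = f a b L_(a+b).  By bilinearity, compatibility and the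
  left-symmetric identity are equivalent to their validity on basis elements.\<close>
definition graded_CLSAS :: "complex set \<Rightarrow> (complex \<Rightarrow> complex \<Rightarrow> complex) \<Rightarrow> bool" where
  "graded_CLSAS G f \<longleftrightarrow>
     (\<forall>a\<in>G. \<forall>b\<in>G. f a b - f b a = b - a) \<and>
     (\<forall>a\<in>G. \<forall>b\<in>G. \<forall>c\<in>G.
        f a b * f (a + b) c - f b c * f a (b + c) =
        f b a * f (b + a) c - f a c * f b (a + c))"

definition V_coeff :: "complex \<Rightarrow> complex \<Rightarrow> complex \<Rightarrow> complex \<Rightarrow> complex" where
  "V_coeff \<alpha> \<theta> b c = (\<alpha> + c + \<alpha> * \<theta> * b) * (1 + \<theta> * c) / (1 + \<theta> * (b + c))"

text \<open>A bilinear form phi on W is determined by psi a b = phi(L_a, L_b).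
  Condition (i) (by trilinearity, equivalent to its validity on basis elements)
  and condition (ii) of the theorem.\<close>
definition virasoro_ext_form ::
  "complex set \<Rightarrow> (complex \<Rightarrow> complex \<Rightarrow> complex) \<Rightarrow> (complex \<Rightarrow> complex \<Rightarrow> complex) \<Rightarrow> bool" where
  "virasoro_ext_form G f \<psi> \<longleftrightarrow>
     (\<forall>a\<in>G. \<forall>b\<in>G. \<forall>c\<in>G.
        f a b * \<psi> (a + b) c - f b c * \<psi> a (b + c) =
        f b a * \<psi> (b + a) c - f a c * \<psi> b (a + c)) \<and>
     (\<forall>a\<in>G. \<forall>b\<in>G. \<psi> a b - \<psi> b a = (b ^ 3 - b) / 12 * kdelta (a + b) 0)"

end

theory Submission
  imports Defs
begin

text \<open>
  The product makes the algebra a module over the Witt algebra, and the degree-zero part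
  h x = phi(L_(-x), L_x) of an extension form is a 1-cocycle with values in its graded dual.
  The eigenvalues of left multiplication by L_0, together with h, force f c 0 = 0 for all c.
  Then s x = f (-x) x is a second cocycle, satisfying the same linear equation as h. On
  \<plusminus>a, \<plusminus>2a the two equations and the prescribed odd parts of s and h give
  s x = x + theta x * x^2 and 24 * theta x * h x = s x * (x - theta x), with theta x nonzero and
  unchanged under x \<mapsto> -x and x \<mapsto> 2x. Eliminating f between the two cocycle
  equations for a + b + c = 0, and separating the homogeneous parts by doubling (a, b, c), yields
  a quadratic relation for x / theta x which makes theta^2 constant. The sign of theta is constant
  because f b y * f (-b) (y+b) - y(y+b) does not change along a coset y + Zb, which is incompatible
  with every other pattern of signs. Finally the cocycle equations determine f from theta.
\<close>

section \<open>Eigenvalues of L_0\<close>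

locale witt_lsa =
  fixes G :: "complex set" and f :: "complex \<Rightarrow> complex \<Rightarrow> complex"
  assumes zero_mem [simp]: "0 \<in> G"
    and add_mem [simp]: "a \<in> G \<Longrightarrow> b \<in> G \<Longrightarrow> a + b \<in> G"
    and uminus_mem [simp]: "a \<in> G \<Longrightarrow> - a \<in> G"
    and comm: "a \<in> G \<Longrightarrow> b \<in> G \<Longrightarrow> f a b - f b a = b - a"
    and lsa: "a \<in> G \<Longrightarrow> b \<in> G \<Longrightarrow> c \<in> G \<Longrightarrow>
      f a b * f (a + b) c - f b c * f a (b + c) = f b a * f (b + a) c - f a c * f b (a + c)"
begin

lemma diff_mem [simp]: "a \<in> G \<Longrightarrow> b \<in> G \<Longrightarrow> a - b \<in> G"
  using add_mem[of a "- b"] by simp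

lemma of_nat_mult_mem: "a \<in> G \<Longrightarrow> of_nat n * a \<in> G"
  by (induction n) (simp_all add: distrib_right)

lemma numeral_mult_mem [simp]: "a \<in> G \<Longrightarrow> numeral n * a \<in> G"
  using of_nat_mult_mem[of a "numeral n"] by simp

lemma mult_numeral_mem [simp]: "a \<in> G \<Longrightarrow> a * numeral n \<in> G"
  using numeral_mult_mem[of a n] by (simp add: mult.commute)

text \<open>Left-symmetry and compatibility say that left multiplications represent the Witt
  algebra: \<open>L_a (L_b L_c) - L_b (L_a L_c) = [L_a, L_b] L_c\<close>. The index sums are
  separate variables so that they can be supplied in simplified form.\<close>

lemma action:
  assumes "a \<in> G" "b \<in> G" "c \<in> G" "a + b = p" "b + c = q" "a + c = r"
  shows "f b c * f a q - f a c * f b r = (b - a) * f p c"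
proof -
  have "f b c * f a q - f a c * f b r = (f a b - f b a) * f p c"
    using lsa[of a b c] assms by (auto simp: algebra_simps)
  then show ?thesis using comm assms by simp
qed

text \<open>L_c has L_0-eigenvalue f 0 c = c + f c 0, and L_a shifts eigenvalues by a.\<close>

lemma right_zero_shift:
  assumes "a \<in> G" "c \<in> G"
  shows "f a c * (f c 0 - f (a + c) 0) = 0"
proof -
  have "f a c * f 0 (a + c) - f 0 c * f a c = a * f a c"
    using action[of 0 a c a "a + c" c] assms by simp
  moreover have "f 0 (a + c) = f (a + c) 0 + (a + c)" "f 0 c = f c 0 + c"
    using comm[of 0 "a + c"] comm[of 0 c] assms by (simp_all add: algebra_simps)
  ultimately show ?thesis by (auto simp: algebra_simps)
qed

lemma right_zero_cases:
  assumes "a \<in> G"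
  shows "f a 0 = 0 \<or> f a 0 = f 0 0"
  using right_zero_shift[of a 0] assms by auto

text \<open>For \<open>a \<noteq> c\<close> compatibility makes one of \<open>f a c\<close>,
  \<open>f c a\<close> nonzero, and by the shift relation that product carries the common value to
  \<open>a + c\<close>.\<close>

lemma right_zero_add:
  assumes "a \<in> G" "c \<in> G" "a \<noteq> c" "f a 0 = t" "f c 0 = t"
  shows "f (a + c) 0 = t"
proof -
  have "f a c \<noteq> 0 \<or> f c a \<noteq> 0" using comm[of a c] assms by auto
  then show ?thesis
    using right_zero_shift[of a c] right_zero_shift[of c a] assms by (auto simp: add.commute)
qed

lemma right_zero_neq:
  assumes "a \<in> G" "c \<in> G" "f c 0 \<noteq> f (a + c) 0"
  shows "f a c = 0" "f c a = a - c"
  using right_zero_shift[of a c] comm[of c a] assms by auto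

text \<open>On such a half line f(-3u, -3u) is determined by the action of L_4u as well as by that of
  L_5u, with different results.\<close>

lemma half_line_false:
  assumes u: "u \<in> G" "u \<noteq> 0" and f0: "f 0 0 \<noteq> 0" and fu: "f u 0 \<noteq> 0"
    and dich: "\<And>n. n \<in> {1, 2, 3} \<Longrightarrow> (f (n * u) 0 = 0) \<noteq> (f (- (n * u)) 0 = 0)"
  shows False
proof -
  have g1: "f u 0 = f 0 0" using right_zero_cases[OF u(1)] fu by auto
  have gm1: "f (- u) 0 = 0" using dich[of 1] fu by auto
  \<comment> \<open>Otherwise the dichotomy puts the value \<open>f 0 0\<close> at
    \<open>-2u\<close>, and adding \<open>u\<close> gives it at \<open>-u\<close>.\<close>
  have g2: "f (2 * u) 0 = f 0 0"
  proof (rule ccontr)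
    assume "f (2 * u) 0 \<noteq> f 0 0"
    then have "f (2 * u) 0 = 0" using right_zero_cases[of "2 * u"] u by auto
    then have "f (- (2 * u)) 0 = f 0 0"
      using dich[of 2] right_zero_cases[of "- (2 * u)"] u by auto
    then have "f (u + - (2 * u)) 0 = f 0 0"
      using right_zero_add[of u "- (2 * u)"] u g1 by auto
    then show False using gm1 f0 by simp
  qed
  have g3: "f (3 * u) 0 = f 0 0" using right_zero_add[of u "2 * u"] u g1 g2 by auto
  have g4: "f (4 * u) 0 = f 0 0" using right_zero_add[of u "3 * u"] u g1 g3 by auto
  have g5: "f (5 * u) 0 = f 0 0" using right_zero_add[of u "4 * u"] u g1 g4 by auto
  have gm2: "f (- (2 * u)) 0 = 0" using dich[of 2] f0 g2 by auto
  have gm3: "f (- (3 * u)) 0 = 0" using dich[of 3] f0 g3 by auto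
  \<comment> \<open>The commutator of \<open>L_a\<close> and \<open>L_(-3u)\<close> is applied to
    \<open>L_(-3u)\<close>. The zero pattern at \<open>a\<close>, \<open>a - 3u\<close>,
    \<open>a - 6u\<close> fixes every coefficient except \<open>f (-3u) (-3u)\<close>; it is met by
    \<open>a = 4u\<close> and \<open>a = 5u\<close>.\<close>
  have diag: "(- (3 * u) - a) * (- (3 * u) - (a + - (3 * u)))
      = f (- (3 * u)) (- (3 * u)) * (- (6 * u) - a)"
    if a: "a \<in> G" "f a 0 \<noteq> 0" "f (a + - (3 * u)) 0 \<noteq> 0" "f (a + - (6 * u)) 0 = 0" for a
  proof -
    have "f a (- (3 * u)) = 0"
      using right_zero_neq(1)[of a "- (3 * u)"] u gm3 a by auto
    moreover have "f a (- (6 * u)) = - (6 * u) - a"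
      using right_zero_neq(2)[of "- (6 * u)" a] u a by (simp add: add.commute)
    moreover have "f (a + - (3 * u)) (- (3 * u)) = - (3 * u) - (a + - (3 * u))"
      using right_zero_neq(2)[of "- (3 * u)" "a + - (3 * u)"] u a by (simp add: algebra_simps)
    moreover have "f (- (3 * u)) (- (3 * u)) * f a (- (6 * u))
        - f a (- (3 * u)) * f (- (3 * u)) (a + - (3 * u))
        = (- (3 * u) - a) * f (a + - (3 * u)) (- (3 * u))"
      by (rule action) (use u a in simp_all)
    ultimately show ?thesis by simp
  qed
  define D where "D = f (- (3 * u)) (- (3 * u))"
  have "u * (14 * u + 5 * D) = 0"
    using diag[of "4 * u"] u g1 g4 gm2 f0 unfolding D_def[symmetric] by (simp add: algebra_simps)
  moreover have "u * (40 * u + 11 * D) = 0"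
    using diag[of "5 * u"] u g2 g5 gm1 f0 unfolding D_def[symmetric] by (simp add: algebra_simps)
  ultimately have "5 * D = - 14 * u" "11 * D = - 40 * u"
    using u(2) by (simp_all add: add_eq_0_iff)
  then have "11 * (- 14 * u) = 5 * (- 40 * u)" by (metis mult.left_commute)
  then show False using u(2) by simp
qed

text \<open>Condition (i) on basis triples of total degree 0, with \<open>w x\<close> in the role of
  the form at \<open>(L_(-x), L_x)\<close>; compatibility has replaced \<open>f a b - f b a\<close>
  by \<open>b - a\<close>.\<close>

definition cocycle :: "(complex \<Rightarrow> complex) \<Rightarrow> bool" where
  "cocycle w \<longleftrightarrow> (\<forall>a\<in>G. \<forall>b\<in>G. \<forall>c\<in>G. a + b + c = 0 \<longrightarrow>
     w (- a) * f b c - w (- b) * f a c = (b - a) * w c)"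

lemma cocycleD:
  assumes "cocycle w" "a \<in> G" "b \<in> G" "c \<in> G" "a + b + c = 0"
  shows "w (- a) * f b c - w (- b) * f a c = (b - a) * w c"
  using assms unfolding cocycle_def by blast

definition virasoro_odd :: "(complex \<Rightarrow> complex) \<Rightarrow> bool" where
  "virasoro_odd h \<longleftrightarrow> (\<forall>x\<in>G. h x - h (- x) = (x ^ 3 - x) / 12)"

text \<open>If \<open>f 0 0\<close> were nonzero, the cocycle \<open>h\<close> would force exactly
  one of \<open>f x 0\<close>, \<open>f (-x) 0\<close> to vanish for all nonzero \<open>x\<close>
  with at most two exceptions, which \<open>half_line_false\<close> excludes. Once
  \<open>f 0 0 = 0\<close>, the two possible values of \<open>f c 0\<close> coincide.\<close>

lemma right_zero:
  assumes h: "cocycle h" "virasoro_odd h" and w: "w \<in> G" "w \<noteq> 0" and c: "c \<in> G"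
  shows "f c 0 = 0"
proof -
  have gh: "f x 0 * h x = f (- x) x * h 0" if "x \<in> G" for x
    using cocycleD[OF h(1), of 0 "- x" x] comm[of 0 x] that by (simp add: algebra_simps)
  have "f 0 0 = 0"
  proof (rule ccontr)
    assume f0: "f 0 0 \<noteq> 0"
    have dich: "(f x 0 = 0) \<noteq> (f (- x) 0 = 0)"
      if x: "x \<in> G" "x \<noteq> 0" "f 0 0 * (x\<^sup>2 - 1) \<noteq> 24 * h 0" for x
    proof -
      have "f x 0 \<noteq> 0 \<or> f (- x) 0 \<noteq> 0"
        using right_zero_add[of x "- x" 0] x f0 by auto
      moreover have "\<not> (f x 0 \<noteq> 0 \<and> f (- x) 0 \<noteq> 0)"
      proof
        assume "f x 0 \<noteq> 0 \<and> f (- x) 0 \<noteq> 0"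
        then have "f x 0 = f 0 0" "f (- x) 0 = f 0 0"
          using right_zero_cases[of x] right_zero_cases[of "- x"] x by auto
        \<comment> \<open>Both differences are prescribed, so only the exceptional values of
          \<open>x^2\<close> survive.\<close>
        then have "f 0 0 * (h x - h (- x)) = (f (- x) x - f x (- x)) * h 0"
          using gh[of x] gh[of "- x"] x by (simp add: algebra_simps)
        then have "f 0 0 * ((x ^ 3 - x) / 12) = 2 * x * h 0"
          using h(2) comm[of "- x" x] x unfolding virasoro_odd_def by simp
        then have "x * (f 0 0 * (x\<^sup>2 - 1)) = x * (24 * h 0)"
          by (simp add: field_simps power2_eq_square power3_eq_cube)
        then show False using x by simp
      qed
      ultimately show ?thesis by blast
    qed
    \<comment> \<open>The exceptional value of \<open>x^2\<close>. The multiple \<open>u\<close> of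
      \<open>w\<close> is taken so large that none of \<open>u\<close>, \<open>2u\<close>,
      \<open>3u\<close> is exceptional.\<close>
    define d where "d = 1 + 24 * h 0 / f 0 0"
    obtain N :: nat where N: "norm d < real N * (norm w)\<^sup>2"
      using reals_Archimedean3[of "(norm w)\<^sup>2"] w by auto
    then have "N > 0" by (cases N) auto
    define u where "u = of_nat N * w"
    have u: "u \<in> G" "u \<noteq> 0" using of_nat_mult_mem w \<open>N > 0\<close> by (auto simp: u_def)
    have "real N * (norm w)\<^sup>2 \<le> (real N)\<^sup>2 * (norm w)\<^sup>2"
      using \<open>N > 0\<close> by (intro mult_right_mono) (auto simp: power2_eq_square)
    also have "\<dots> = (norm u)\<^sup>2" by (simp add: u_def norm_mult power_mult_distrib)
    finally have nu: "norm d < (norm u)\<^sup>2" using N by simp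
    have generic: "f 0 0 * ((n * u)\<^sup>2 - 1) \<noteq> 24 * h 0" if "norm n \<ge> 1" for n
    proof
      assume "f 0 0 * ((n * u)\<^sup>2 - 1) = 24 * h 0"
      then have "(n * u)\<^sup>2 = d" using f0 by (simp add: d_def field_simps)
      then have "norm d = (norm n)\<^sup>2 * (norm u)\<^sup>2"
        by (metis norm_power norm_mult power_mult_distrib)
      moreover have "1 * (norm u)\<^sup>2 \<le> (norm n)\<^sup>2 * (norm u)\<^sup>2"
        using that by (intro mult_right_mono) auto
      ultimately show False using nu by simp
    qed
    have d1: "(f (n * u) 0 = 0) \<noteq> (f (- (n * u)) 0 = 0)" if "n \<in> {1, 2, 3}" for n
      using dich[of "n * u"] generic[of n] that u by auto
    show False
    proof (cases "f u 0 = 0")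
      case False
      then show False using half_line_false[OF u f0] d1 by blast
    next
      case True
      then have "f (- u) 0 \<noteq> 0" using d1[of 1] by simp
      moreover have "(f (n * - u) 0 = 0) \<noteq> (f (- (n * - u)) 0 = 0)" if "n \<in> {1, 2, 3}" for n
        using d1[OF that] by auto
      ultimately show False using half_line_false[of "- u"] u f0 by auto
    qed
  qed
  then show ?thesis using right_zero_cases[OF c] by auto
qed

end

section \<open>The cocycles on a line\<close>

locale weight_lsa = witt_lsa +
  assumes right_zero_eq [simp]: "c \<in> G \<Longrightarrow> f c 0 = 0"
begin

lemma left_zero [simp]: "c \<in> G \<Longrightarrow> f 0 c = c"
  using comm[of 0 c] by simp

text \<open>The coefficient in \<open>L_(-c) L_c = s c L_0\<close>. It is a cocycle because the
  module relation for \<open>a + b + c = 0\<close> takes values in multiples of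
  \<open>L_0\<close>.\<close>

definition s :: "complex \<Rightarrow> complex" where "s c = f (- c) c"

lemma s_cocycle: "cocycle s"
  unfolding cocycle_def s_def
proof (intro ballI impI)
  fix a b c assume m: "a \<in> G" "b \<in> G" "c \<in> G" and e: "a + b + c = 0"
  have q: "b + c = - a" "a + c = - b" "a + b = - c" using e by algebra+
  show "f (- (- a)) (- a) * f b c - f (- (- b)) (- b) * f a c = (b - a) * f (- c) c"
    using action[OF m q(3) q(1) q(2)] by (simp add: mult.commute)
qed

lemma s_odd: "x \<in> G \<Longrightarrow> s x - s (- x) = 2 * x"
  using comm[of "- x" x] by (simp add: s_def)

text \<open>Both are round trips from \<open>L_y\<close> by \<open>L_b\<close> and back by
  \<open>L_(-b)\<close>, with the value \<open>y (y + b)\<close>. For \<open>y = b = a\<close> the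
  chain of shifts by \<open>b\<close> passes through \<open>L_0\<close>, which gives the value at
  once. For \<open>b = 2a\<close>, \<open>y = -a\<close> it avoids \<open>L_0\<close>, so a detour
  through \<open>L_(3a)\<close> is made.\<close>

lemma line_products:
  assumes a: "a \<in> G" "a \<noteq> 0"
  shows "f a a * f (- a) (2 * a) = 2 * a\<^sup>2"
    and "f (- (2 * a)) a * f (2 * a) (- a) = - a\<^sup>2"
proof -
  show 1: "f a a * f (- a) (2 * a) = 2 * a\<^sup>2"
    using action[of a "- a" a 0 0 "2 * a"] a by (simp add: power2_eq_square algebra_simps)
  have 2: "f a (2 * a) * f (- a) (3 * a) = 6 * a\<^sup>2"
  proof -
    have "f (- a) (2 * a) * f a a - f a (2 * a) * f (- a) (3 * a) = (- a - a) * (2 * a)"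
      using action[of a "- a" "2 * a" 0 a "3 * a"] a by simp
    then show ?thesis using 1 by (simp add: power2_eq_square algebra_simps)
  qed
  have 3: "f (2 * a) a * f (- a) (3 * a) = 3 * a * f a a"
    using action[of "- a" "2 * a" a a "3 * a" 0] a by simp
  have 4: "f a (2 * a) * f (- (2 * a)) (3 * a) = 3 * a * f (- a) (2 * a)"
    using action[of a "- (2 * a)" "2 * a" "- a" 0 "3 * a"] a by simp
  \<comment> \<open>The product of 3 and 4 contains both factors of 2; what remains on the right is
    the product known from 1.\<close>
  have "6 * a\<^sup>2 * (f (2 * a) a * f (- (2 * a)) (3 * a))
      = (f (2 * a) a * f (- a) (3 * a)) * (f a (2 * a) * f (- (2 * a)) (3 * a))"
    unfolding 2[symmetric] by (simp add: algebra_simps)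
  also have "\<dots> = 9 * a\<^sup>2 * (f a a * f (- a) (2 * a))"
    unfolding 3 4 by (simp add: algebra_simps power2_eq_square)
  finally have "f (2 * a) a * f (- (2 * a)) (3 * a) = 3 * a\<^sup>2"
    unfolding 1 using a(2) by (simp add: power2_eq_square)
  moreover have "f (- (2 * a)) a * f (2 * a) (- a) - f (2 * a) a * f (- (2 * a)) (3 * a)
      = (- (2 * a) - 2 * a) * a"
    using action[of "2 * a" "- (2 * a)" a 0 "- a" "3 * a"] a by simp
  ultimately show "f (- (2 * a)) a * f (2 * a) (- a) = - a\<^sup>2"
    by (simp add: power2_eq_square algebra_simps)
qed

end

locale virasoro_lsa = weight_lsa +
  fixes h :: "complex \<Rightarrow> complex"
  assumes h_cocycle: "cocycle h" and h_odd: "virasoro_odd h"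
begin

text \<open>For \<open>V_(0,t)\<close> one has \<open>s x = x (1 + t x)\<close>, so this recovers
  \<open>t\<close> at every nonzero \<open>x\<close>.\<close>

definition theta :: "complex \<Rightarrow> complex" where
  "theta x = (s x - x) / x\<^sup>2"

text \<open>The products among \<open>L_a\<close>, \<open>L_(-a)\<close>, \<open>L_(2a)\<close>,
  \<open>L_(-2a)\<close> that occur here depend on one parameter \<open>v\<close>. A cocycle at
  \<open>2a\<close> and \<open>-2a\<close> is then determined by its values at \<open>a\<close> and
  \<open>-a\<close>, and the prescribed odd parts at \<open>a\<close> and \<open>2a\<close> give
  linear equations for \<open>s (-a)\<close> and \<open>h (-a)\<close>.\<close>

lemma line_values:
  assumes a: "a \<in> G" "a \<noteq> 0"
  obtains t where "t \<noteq> 0" "s a = a + t * a\<^sup>2" "s (- a) = - a + t * a\<^sup>2"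
    "s (2 * a) = 2 * a + 4 * t * a\<^sup>2" "s a \<noteq> 0" "24 * t * h a = s a * (a - t)"
proof -
  \<comment> \<open>For the product V_(0,t) this is v = (1 - ta) / (1 + ta).\<close>
  define v where "v = - f (2 * a) (- a) / a"
  have Y: "f (2 * a) (- a) = - a * v" using a by (simp add: v_def)
  have v0: "v \<noteq> 0" using line_products(2)[OF a] a Y by auto
  have X: "f (- (2 * a)) a * v = a"
    using line_products(2)[OF a] a unfolding Y by (simp add: power2_eq_square)
  have "f (- a) (2 * a) = a * (3 - v)"
    using comm[of "- a" "2 * a"] a Y by (simp add: algebra_simps)
  then have F: "f a a * (3 - v) = 2 * a"
    using line_products(1)[OF a] a by (simp add: power2_eq_square)
  have "f a (- (2 * a)) = f (- (2 * a)) a - 3 * a"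
    using comm[of a "- (2 * a)"] a by (simp add: algebra_simps)
  then have "f a (- (2 * a)) * v = a * (1 - 3 * v)"
    using X by algebra
  moreover have "f (- a) (- a) * f a (- (2 * a)) = 2 * a\<^sup>2"
    using line_products(1)[of "- a"] a by simp
  ultimately have "f (- a) (- a) * (a * (1 - 3 * v)) = 2 * a\<^sup>2 * v"
    by (metis mult.assoc)
  then have M: "f (- a) (- a) * (1 - 3 * v) = 2 * a * v"
    using a by (simp add: power2_eq_square)
  \<comment> \<open>The cocycle equations for \<open>(a, -2a, a)\<close> and
    \<open>(-a, 2a, -a)\<close>, with \<open>f a a\<close> and \<open>f (-a) (-a)\<close> eliminated
    by \<open>F\<close> and \<open>M\<close>.\<close>
  have w2: "2 * v * w (2 * a) = (3 - v) * (w (- a) + 3 * v * w a)"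
    and wm2: "2 * v * w (- (2 * a)) = - (1 - 3 * v) * (v * w a + 3 * w (- a))"
    if w: "cocycle w" for w
  proof -
    have "w (- a) * f (- (2 * a)) a - w (2 * a) * f a a = - 3 * a * w a"
      using cocycleD[OF w, of a "- (2 * a)" a] a by simp
    with F X have "a * (2 * v * w (2 * a)) = a * ((3 - v) * (w (- a) + 3 * v * w a))"
      by algebra
    then show "2 * v * w (2 * a) = (3 - v) * (w (- a) + 3 * v * w a)" using a by simp
    have "w a * (- a * v) - w (- (2 * a)) * f (- a) (- a) = 3 * a * w (- a)"
      using cocycleD[OF w, of "- a" "2 * a" "- a"] a unfolding Y by simp
    with M have "a * (2 * v * w (- (2 * a))) = a * (- (1 - 3 * v) * (v * w a + 3 * w (- a)))"
      by algebra
    then show "2 * v * w (- (2 * a)) = - (1 - 3 * v) * (v * w a + 3 * w (- a))" using a by simp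
  qed
  have key: "v * (w (2 * a) - w (- (2 * a))) = v * w a * (5 - 3 * v) + w (- a) * (3 - 5 * v)"
    if w: "cocycle w" for w
  proof -
    have "2 * (v * (w (2 * a) - w (- (2 * a)))) = 2 * (v * w a * (5 - 3 * v) + w (- a) * (3 - 5 * v))"
      using w2[OF w] wm2[OF w] by algebra
    then show ?thesis unfolding mult_cancel_left by simp
  qed
  have s1: "s a = s (- a) + 2 * a" and s2: "s (2 * a) - s (- (2 * a)) = 4 * a"
    using s_odd[of a] s_odd[of "2 * a"] a by (simp_all add: algebra_simps)
  have h1: "12 * h a = 12 * h (- a) + a ^ 3 - a"
    and h2: "12 * (h (2 * a) - h (- (2 * a))) = 8 * a ^ 3 - 2 * a"
    using bspec[OF h_odd[unfolded virasoro_odd_def], of a]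
      bspec[OF h_odd[unfolded virasoro_odd_def], of "2 * a"] a
    by (simp_all add: field_simps power_mult_distrib)
  have "3 * ((1 - v) * ((1 + v) * s (- a) + 2 * a * v)) = 0"
    using key[OF s_cocycle] s1 s2 by algebra
  then have sm: "v = 1 \<or> (1 + v) * s (- a) = - 2 * a * v"
    by (auto simp: add_eq_0_iff)
  have "3 * (12 * (1 - v\<^sup>2) * h (- a)) = 3 * (v * (a ^ 3 * (1 + v) + a * (1 - v)))"
    using key[OF h_cocycle] h1 h2 by algebra
  then have hm: "12 * (1 - v\<^sup>2) * h (- a) = v * (a ^ 3 * (1 + v) + a * (1 - v))" by simp
  \<comment> \<open>The equation for \<open>s\<close> leaves \<open>v = 1\<close> open; the one for
    \<open>h\<close> would then read \<open>0 = 2 a^3\<close>.\<close>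
  have v1: "v \<noteq> 1" using hm a by auto
  then have sm: "(1 + v) * s (- a) = - 2 * a * v" using sm by simp
  then have vm1: "1 + v \<noteq> 0" using a v0 by auto
  have sa: "(1 + v) * s a = 2 * a" using sm s1 by algebra
  \<comment> \<open>The solution of \<open>v = (1 - t a) / (1 + t a)\<close>.\<close>
  define t where "t = (1 - v) / (a * (1 + v))"
  have t: "t * a * (1 + v) = 1 - v" using a vm1 by (simp add: t_def)
  show ?thesis
  proof
    show "t \<noteq> 0" using t v1 by auto
    show "s a \<noteq> 0" using sa a by auto
    have "(1 + v) * s a = (1 + v) * (a + t * a\<^sup>2)" using sa t by algebra
    then show sa': "s a = a + t * a\<^sup>2" using vm1 by simp
    then show sma': "s (- a) = - a + t * a\<^sup>2" using s1 by algebra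
    have "2 * v * (1 + v) * s (2 * a) = 2 * v * (1 + v) * (2 * a + 4 * t * a\<^sup>2)"
      using w2[OF s_cocycle] sa sm t by algebra
    then show "s (2 * a) = 2 * a + 4 * t * a\<^sup>2" using v0 vm1 by simp
    have "(1 - v\<^sup>2) * (1 + v) * (24 * t * h a) = (1 - v\<^sup>2) * (1 + v) * (s a * (a - t))"
      using hm h1 sa t by algebra
    moreover have "1 - v\<^sup>2 \<noteq> 0" using v1 vm1
      by (metis add_eq_0_iff eq_iff_diff_eq_0 power2_eq_1_iff add.inverse_inverse add.commute)
    ultimately show "24 * t * h a = s a * (a - t)" using vm1 by simp
  qed
qed

lemma theta_values:
  assumes a: "a \<in> G" "a \<noteq> 0"
  shows theta_nz: "theta a \<noteq> 0" and s_eq: "s a = a + theta a * a\<^sup>2"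
    and theta_minus: "theta (- a) = theta a" and theta_double: "theta (2 * a) = theta a"
    and s_nz: "s a \<noteq> 0" and h_eq: "24 * theta a * h a = s a * (a - theta a)"
proof -
  obtain t where t: "t \<noteq> 0" "s a = a + t * a\<^sup>2" "s (- a) = - a + t * a\<^sup>2"
    "s (2 * a) = 2 * a + 4 * t * a\<^sup>2" "s a \<noteq> 0" "24 * t * h a = s a * (a - t)"
    using line_values[OF a] .
  have th: "theta a = t" using t(2) a by (simp add: theta_def)
  show "theta a \<noteq> 0" "s a = a + theta a * a\<^sup>2" "s a \<noteq> 0"
    "24 * theta a * h a = s a * (a - theta a)" using t th by auto
  show "theta (- a) = theta a" "theta (2 * a) = theta a"
    using t(3,4) a th by (simp_all add: theta_def power_mult_distrib)
qed

section \<open>Constancy of theta\<close>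

text \<open>Chosen so that \<open>24 * h x = s x * (l x - 1)\<close>, which makes \<open>h\<close> a
  multiple of \<open>s\<close> by an odd function minus a constant. Constancy of
  \<open>theta\<close> amounts to linearity of \<open>l\<close>.\<close>

definition l :: "complex \<Rightarrow> complex" where "l x = x / theta x"

lemma l_minus: "a \<in> G \<Longrightarrow> a \<noteq> 0 \<Longrightarrow> l (- a) = - l a"
  by (simp add: l_def theta_minus)

lemma l_double: "a \<in> G \<Longrightarrow> a \<noteq> 0 \<Longrightarrow> l (2 * a) = 2 * l a"
  by (simp add: l_def theta_double)

lemma h_eq_l: "a \<in> G \<Longrightarrow> a \<noteq> 0 \<Longrightarrow> 24 * h a = s a * (l a - 1)"
  using h_eq[of a] theta_nz[of a] by (simp add: l_def field_simps)

text \<open>Elimination of \<open>f a c\<close> between the cocycle equations of \<open>s\<close>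
  and \<open>h\<close>.\<close>

lemma product_eq:
  assumes m: "a \<in> G" "b \<in> G" "c \<in> G" and nz: "a \<noteq> 0" "b \<noteq> 0" "c \<noteq> 0" and e: "a + b + c = 0"
  shows "s (- a) * f b c * (l b - l a) = (b - a) * s c * (l b + l c)"
proof -
  have 1: "s (- a) * f b c - s (- b) * f a c = (b - a) * s c"
    using cocycleD[OF s_cocycle m e] .
  have 2: "h (- a) * f b c - h (- b) * f a c = (b - a) * h c"
    using cocycleD[OF h_cocycle m e] .
  have "24 * h (- a) = s (- a) * (- l a - 1)" "24 * h (- b) = s (- b) * (- l b - 1)"
    "24 * h c = s c * (l c - 1)"
    using h_eq_l[of "- a"] h_eq_l[of "- b"] h_eq_l[of c] m nz by (simp_all add: l_minus)
  then show ?thesis using 1 2 by algebra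
qed

text \<open>\<open>product_eq\<close> for \<open>(a, b, c)\<close> and \<open>(a, c, b)\<close>
  computes \<open>f b c\<close> and \<open>f c b\<close>, whose difference is
  \<open>c - b\<close>.\<close>

lemma l_identity:
  assumes m: "a \<in> G" "b \<in> G" "c \<in> G" and nz: "a \<noteq> 0" "b \<noteq> 0" "c \<noteq> 0" and e: "a + b + c = 0"
  shows "(c - b) * s (- a) * (l b - l a) * (l c - l a)
    = (l b + l c) * ((b - a) * s c * (l c - l a) - (c - a) * s b * (l b - l a))"
proof -
  have "a + c + b = 0" using e by (simp add: algebra_simps)
  then show ?thesis
    using product_eq[OF m nz e] product_eq[of a c b] comm[of b c] m nz by algebra
qed

text \<open>The degree 4 part of \<open>l_identity\<close>: the mixed products of values of
  \<open>l\<close> cancel and only the squares remain.\<close>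

lemma l_square_relation:
  assumes m: "a \<in> G" "b \<in> G" "c \<in> G" and nz: "a \<noteq> 0" "b \<noteq> 0" "c \<noteq> 0" and e: "a + b + c = 0"
  shows "(l a)\<^sup>2 * (b\<^sup>2 - c\<^sup>2) + (l b)\<^sup>2 * (c\<^sup>2 - a\<^sup>2) + (l c)\<^sup>2 * (a\<^sup>2 - b\<^sup>2) = 0"
proof -
  have sv: "s (- a) = - a + theta a * a\<^sup>2" "s b = b + theta b * b\<^sup>2" "s c = c + theta c * c\<^sup>2"
    using s_eq[of "- a"] s_eq[of b] s_eq[of c] m nz by (simp_all add: theta_minus)
  have sv2: "s (- (2 * a)) = - 2 * a + 4 * theta a * a\<^sup>2" "s (2 * b) = 2 * b + 4 * theta b * b\<^sup>2"
    "s (2 * c) = 2 * c + 4 * theta c * c\<^sup>2"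
    using s_eq[of "- (2 * a)"] s_eq[of "2 * b"] s_eq[of "2 * c"] m nz
    by (simp_all add: theta_minus theta_double power_mult_distrib)
  have i1: "(c - b) * s (- a) * (l b - l a) * (l c - l a)
    = (l b + l c) * ((b - a) * s c * (l c - l a) - (c - a) * s b * (l b - l a))"
    using l_identity[OF m nz e] .
  have "2 * a + 2 * b + 2 * c = 0" using e by algebra
  then have i2: "(2 * c - 2 * b) * s (- (2 * a)) * (2 * l b - 2 * l a) * (2 * l c - 2 * l a)
    = (2 * l b + 2 * l c) * ((2 * b - 2 * a) * s (2 * c) * (2 * l c - 2 * l a)
        - (2 * c - 2 * a) * s (2 * b) * (2 * l b - 2 * l a))"
    using l_identity[of "2 * a" "2 * b" "2 * c"] m nz by (simp add: l_double)
  \<comment> \<open>i1 has a part of degree 4 and one of degree 5; i2 weights them with 16 and 32.\<close>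
  have "16 * ((l a)\<^sup>2 * (b\<^sup>2 - c\<^sup>2) + (l b)\<^sup>2 * (c\<^sup>2 - a\<^sup>2) + (l c)\<^sup>2 * (a\<^sup>2 - b\<^sup>2)) = 0"
    using i1 i2 e unfolding sv sv2 by algebra
  then show ?thesis unfolding mult_eq_0_iff by simp
qed

text \<open>The relation is linear in the squares of \<open>l\<close>. Three triples built from
  \<open>b\<close>, \<open>c\<close>, \<open>b + c\<close>, \<open>b - c\<close> and
  \<open>2b\<close> allow the squares at \<open>b + c\<close> and \<open>b - c\<close> to be
  eliminated. The case \<open>c = b\<close> or \<open>c = -b\<close>, where an entry would vanish,
  is separate.\<close>

lemma theta_square_eq:
  assumes m: "b \<in> G" "c \<in> G" and nz: "b \<noteq> 0" "c \<noteq> 0"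
  shows "theta b = theta c \<or> theta b = - theta c"
proof (cases "b = c \<or> b = - c")
  case True
  then show ?thesis using theta_minus m nz by auto
next
  case False
  then have nz': "b + c \<noteq> 0" "b - c \<noteq> 0" "- (b + c) \<noteq> 0" "c - b \<noteq> 0" "- (2 * b) \<noteq> 0"
    using nz by (auto simp: add_eq_0_iff)
  have neg: "l (- (b + c)) = - l (b + c)" "l (c - b) = - l (b - c)" "l (- c) = - l c"
    "l (- (2 * b)) = - 2 * l b"
    using l_minus[of "b + c"] l_minus[of "b - c"] l_minus[of c] l_minus[of "2 * b"] l_double[of b]
      m nz nz' by auto
  have e1: "(l b)\<^sup>2 * (c\<^sup>2 - (- (b + c))\<^sup>2) + (l c)\<^sup>2 * ((- (b + c))\<^sup>2 - b\<^sup>2)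
      + (l (b + c))\<^sup>2 * (b\<^sup>2 - c\<^sup>2) = 0"
    using l_square_relation[of b c "- (b + c)"] m nz nz' unfolding neg by simp
  have e2: "(l b)\<^sup>2 * (c\<^sup>2 - (c - b)\<^sup>2) + (l c)\<^sup>2 * ((c - b)\<^sup>2 - b\<^sup>2)
      + (l (b - c))\<^sup>2 * (b\<^sup>2 - c\<^sup>2) = 0"
    using l_square_relation[of b "- c" "c - b"] m nz nz' unfolding neg by simp
  have e3: "(l (b + c))\<^sup>2 * ((b - c)\<^sup>2 - 4 * b\<^sup>2) + (l (b - c))\<^sup>2 * (4 * b\<^sup>2 - (b + c)\<^sup>2)
      + 4 * (l b)\<^sup>2 * ((b + c)\<^sup>2 - (b - c)\<^sup>2) = 0"
    using l_square_relation[of "b + c" "b - c" "- (2 * b)"] m nz nz' unfolding neg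
    by (simp add: power_mult_distrib)
  have "12 * b * c * (c\<^sup>2 * (l b)\<^sup>2 - b\<^sup>2 * (l c)\<^sup>2) = 0"
    using e1 e2 e3 by algebra
  then have "c\<^sup>2 * (l b)\<^sup>2 = b\<^sup>2 * (l c)\<^sup>2" using nz by simp
  then have "(theta b)\<^sup>2 = (theta c)\<^sup>2"
    using theta_nz[of b] theta_nz[of c] m nz by (simp add: l_def field_simps)
  then show ?thesis by (simp add: power2_eq_iff)
qed

section \<open>The sign of theta along a coset\<close>

definition off :: "complex \<Rightarrow> complex \<Rightarrow> bool" where
  "off b y \<longleftrightarrow> y \<in> G \<and> (\<forall>k::int. y \<noteq> of_int k * b)"

lemma off_neq:
  assumes "off b y"
  shows "y \<noteq> 0" "y + numeral n * b \<noteq> 0" "y + b \<noteq> 0" "y - b \<noteq> 0"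
proof -
  have *: "y \<noteq> of_int k * b" for k using assms by (simp add: off_def)
  show "y \<noteq> 0" "y + numeral n * b \<noteq> 0" "y + b \<noteq> 0" "y - b \<noteq> 0"
    using *[of 0] *[of "- numeral n"] *[of "- 1"] *[of 1] by (auto simp: add_eq_0_iff2)
qed

lemma off_add:
  assumes "off b y" "b \<in> G"
  shows "off b (y + b)"
  unfolding off_def
proof (intro conjI allI)
  show "y + b \<in> G" using assms by (simp add: off_def)
  fix k :: int
  have "y \<noteq> of_int (k - 1) * b" using assms by (simp only: off_def not_False_eq_True)
  then show "y + b \<noteq> of_int k * b" by (auto simp: algebra_simps)
qed

text \<open>The defect of the round trip from \<open>L_y\<close> by \<open>L_b\<close> and
  \<open>L_(-b)\<close>; it is zero for \<open>V_(0,t)\<close>, where the factors containing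
  \<open>t\<close> cancel.\<close>

definition K :: "complex \<Rightarrow> complex \<Rightarrow> complex" where
  "K b y = f b y * f (- b) (y + b) - y * (y + b)"

text \<open>The bracket \<open>[L_b, L_(-b)] = -2b L_0\<close> acts on \<open>L_(y+b)\<close> by
  \<open>-2b (y + b)\<close>, which is \<open>y (y + b) - (y + b) (y + 2b)\<close>.\<close>

lemma K_add:
  assumes "b \<in> G" "y \<in> G"
  shows "K b (y + b) = K b y"
proof -
  have "f (- b) (y + b) * f b y - f b (y + b) * f (- b) (y + b + b) = (- b - b) * (y + b)"
    using action[of b "- b" "y + b" 0 y "y + b + b"] assms by (simp add: algebra_simps)
  then show ?thesis unfolding K_def by algebra
qed

text \<open>Two instances of \<open>product_eq\<close> give the two factors of the round trip, and
  the values of \<open>s\<close> cancel in their product. The four cases are the signs of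
  \<open>theta y\<close> and \<open>theta (y + b)\<close> relative to \<open>theta b\<close>; no
  shift of \<open>y\<close> by a multiple of \<open>b\<close> vanishes, which permits the
  divisions.\<close>

lemma K_values:
  assumes b: "b \<in> G" "b \<noteq> 0" and y: "off b y"
  shows "theta y = theta b \<Longrightarrow> theta (y + b) = theta b \<Longrightarrow> K b y = 0"
    and "theta y = theta b \<Longrightarrow> theta (y + b) \<noteq> theta b \<Longrightarrow> K b y * y = 4 * b * (y + b)\<^sup>2"
    and "theta y \<noteq> theta b \<Longrightarrow> theta (y + b) = theta b \<Longrightarrow> K b y * (y + b) = - 4 * b * y\<^sup>2"
    and "theta y \<noteq> theta b \<Longrightarrow> theta (y + b) \<noteq> theta b \<Longrightarrow>
      (K b y + 4 * b\<^sup>2) * (y * (y + b)) = 4 * b ^ 4"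
proof -
  define t where "t = theta b"
  have t0: "t \<noteq> 0" using theta_nz b by (simp add: t_def)
  have yG: "y \<in> G" using y by (simp add: off_def)
  have nz: "y \<noteq> 0" "y + b \<noteq> 0" "y - b \<noteq> 0" "y + 2 * b \<noteq> 0"
    using off_neq[OF y] by auto
  have nz': "- b \<noteq> y" "- y \<noteq> b" using nz(2) by auto
  have lb: "l b = b / t" by (simp add: l_def t_def)
  have m1: "s (y + b) * f b y * (l b + l (y + b)) = (y + 2 * b) * s y * (l b + l y)"
    using product_eq[of "- (y + b)" b y] l_minus[of "y + b"] b yG nz nz'
    by (simp add: algebra_simps)
  have m2: "s y * f (- b) (y + b) * (l y - l b) = (y - b) * s (y + b) * (l (y + b) - l b)"
    using product_eq[of "- y" "- b" "y + b"] l_minus[of y] l_minus[of b] b yG nz nz'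
    by (simp add: algebra_simps)
  define P where "P = f b y * f (- b) (y + b)"
  have KP: "K b y = P - y * (y + b)" by (simp add: K_def P_def)
  have "s y * s (y + b) * (P * (l b + l (y + b)) * (l y - l b))
      = s y * s (y + b) * ((y + 2 * b) * (y - b) * (l b + l y) * (l (y + b) - l b))"
    unfolding P_def using m1 m2 by algebra
  then have P: "P * (l b + l (y + b)) * (l y - l b) = (y + 2 * b) * (y - b) * (l b + l y) * (l (y + b) - l b)"
    using s_nz[of y] s_nz[of "y + b"] b yG nz by simp
  \<comment> \<open>Here \<open>e\<close> and \<open>e'\<close> are the two relative signs, each 1
    or -1, and \<open>t\<close> has been cleared.\<close>
  have main: "P * (b + e' * (y + b)) * (e * y - b) = (y + 2 * b) * (y - b) * (b + e * y) * (e' * (y + b) - b)"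
    if "l y = e * y / t" "l (y + b) = e' * (y + b) / t" for e e'
  proof -
    have tl: "t * l b = b" "t * l y = e * y" "t * l (y + b) = e' * (y + b)"
      using t0 unfolding that lb by simp_all
    have "(P * (t * l b + t * l (y + b)) * (t * l y - t * l b))
        = t\<^sup>2 * (P * (l b + l (y + b)) * (l y - l b))" by algebra
    also have "\<dots> = (y + 2 * b) * (y - b) * (t * l b + t * l y) * (t * l (y + b) - t * l b)"
      unfolding P by algebra
    finally show ?thesis unfolding tl .
  qed
  have plus: "l x = 1 * x / t" if "theta x = theta b" for x
    using that by (simp add: l_def t_def)
  have minus: "l x = (- 1) * x / t" if "theta x \<noteq> theta b" "x \<in> G" "x \<noteq> 0" for x
    using that theta_square_eq[of x b] b by (simp add: l_def t_def)
  have ybG: "y + b \<in> G" using b yG by simp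
  show "K b y = 0" if "theta y = theta b" "theta (y + b) = theta b"
  proof -
    have "(y + 2 * b) * (y - b) * (P - y * (y + b)) = 0"
      using main[OF plus[OF that(1)] plus[OF that(2)]] by algebra
    then show ?thesis using nz by (simp add: KP)
  qed
  show "K b y * y = 4 * b * (y + b)\<^sup>2" if "theta y = theta b" "theta (y + b) \<noteq> theta b"
  proof -
    have "(y - b) * (K b y * y - 4 * b * (y + b)\<^sup>2) = 0"
      using main[OF plus[OF that(1)] minus[OF that(2) ybG nz(2)]] unfolding KP by algebra
    then show ?thesis using nz by simp
  qed
  show "K b y * (y + b) = - 4 * b * y\<^sup>2" if "theta y \<noteq> theta b" "theta (y + b) = theta b"
  proof -
    have "(y + 2 * b) * (K b y * (y + b) - (- 4 * b * y\<^sup>2)) = 0"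
      using main[OF minus[OF that(1) yG nz(1)] plus[OF that(2)]] unfolding KP by algebra
    then show ?thesis
      using nz(4) unfolding mult_eq_0_iff right_minus_eq by blast
  qed
  show "(K b y + 4 * b\<^sup>2) * (y * (y + b)) = 4 * b ^ 4"
    if "theta y \<noteq> theta b" "theta (y + b) \<noteq> theta b"
    using main[OF minus[OF that(1) yG nz(1)] minus[OF that(2) ybG nz(2)]] unfolding KP by algebra
qed

text \<open>By \<open>K_add\<close> the values of \<open>K\<close> for the pairs starting at
  \<open>y\<close> and \<open>y + b\<close> agree. This excludes the consecutive relative signs - +
  +, + - + and - - -.\<close>

lemma sign_patterns:
  assumes b: "b \<in> G" "b \<noteq> 0" and y: "off b y"
  shows "theta y \<noteq> theta b \<Longrightarrow> theta (y + b) = theta b \<Longrightarrow> theta (y + b + b) \<noteq> theta b"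
    and "theta y = theta b \<Longrightarrow> theta (y + b) \<noteq> theta b \<Longrightarrow> theta (y + b + b) \<noteq> theta b"
    and "theta y \<noteq> theta b \<Longrightarrow> theta (y + b) \<noteq> theta b \<Longrightarrow> theta (y + b + b) = theta b"
proof -
  note nz = off_neq[OF y]
  note y' = off_add[OF y b(1)]
  have yG: "y \<in> G" using y by (simp add: off_def)
  note kadd = K_add[OF b(1) yG]
  note k = K_values[OF b y] and k' = K_values[OF b y', unfolded kadd]
  show "theta (y + b + b) \<noteq> theta b" if "theta y \<noteq> theta b" "theta (y + b) = theta b"
    using k(3)[OF that] k'(1)[OF that(2)] b nz(1) by auto
  show "theta (y + b + b) \<noteq> theta b" if "theta y = theta b" "theta (y + b) \<noteq> theta b"
  proof
    assume "theta (y + b + b) = theta b"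
    then have 1: "K b y * (y + b + b) = - 4 * b * (y + b)\<^sup>2" using k'(3)[OF that(2)] by simp
    have 2: "K b y * y = 4 * b * (y + b)\<^sup>2" using k(2)[OF that] .
    have "2 * K b y * (y + b) = 0" using 1 2 by algebra
    then have "K b y = 0" using nz by simp
    then show False using 2 b nz by simp
  qed
  show "theta (y + b + b) = theta b" if "theta y \<noteq> theta b" "theta (y + b) \<noteq> theta b"
  proof (rule ccontr)
    assume "theta (y + b + b) \<noteq> theta b"
    then have 1: "(K b y + 4 * b\<^sup>2) * ((y + b) * (y + b + b)) = 4 * b ^ 4" using k'(4)[OF that(2)] by simp
    have 2: "(K b y + 4 * b\<^sup>2) * (y * (y + b)) = 4 * b ^ 4" using k(4)[OF that] .
    have "(K b y + 4 * b\<^sup>2) * (y + b) * (2 * b) = 0" using 1 2 by algebra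
    then have "K b y + 4 * b\<^sup>2 = 0" using nz b by simp
    then show False using 2 b by simp
  qed
qed

text \<open>Two minus signs continue as - - + - -, and the values of \<open>K\<close> from the two
  outer pairs contradict each other.\<close>

lemma no_two_negative:
  assumes b: "b \<in> G" "b \<noteq> 0" and y: "off b y"
    and neg: "theta y \<noteq> theta b" "theta (y + b) \<noteq> theta b"
  shows False
proof -
  note y1 = off_add[OF y b(1)]
  note y2 = off_add[OF y1 b(1)]
  note y3 = off_add[OF y2 b(1)]
  have mem: "y \<in> G" "y + b \<in> G" "y + b + b \<in> G" using y y1 y2 by (auto simp: off_def)
  have p2: "theta (y + b + b) = theta b" using sign_patterns(3)[OF b y neg] .
  have p3: "theta (y + b + b + b) \<noteq> theta b" using sign_patterns(1)[OF b y1 neg(2) p2] .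
  have p4: "theta (y + b + b + b + b) \<noteq> theta b" using sign_patterns(2)[OF b y2 p2 p3] .
  have 1: "(K b y + 4 * b\<^sup>2) * (y * (y + b)) = 4 * b ^ 4" using K_values(4)[OF b y neg] .
  have "K b (y + b + b + b) = K b y"
    using K_add[OF b(1) mem(1)] K_add[OF b(1) mem(2)] K_add[OF b(1) mem(3)] by simp
  then have 2: "(K b y + 4 * b\<^sup>2) * ((y + b + b + b) * (y + b + b + b + b)) = 4 * b ^ 4"
    using K_values(4)[OF b y3 p3 p4] by simp
  have "(K b y + 4 * b\<^sup>2) * (6 * b) * (y + 2 * b) = 0" using 1 2 by algebra
  then have "K b y + 4 * b\<^sup>2 = 0" using b off_neq[OF y] by simp
  then show False using 1 b by simp
qed

text \<open>A minus sign is followed either by another one or by + - -, so two adjacent minus signs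
  occur in any case.\<close>

lemma theta_eq_off:
  assumes b: "b \<in> G" "b \<noteq> 0" and y: "off b y"
  shows "theta y = theta b"
proof (rule ccontr)
  assume n0: "theta y \<noteq> theta b"
  note y1 = off_add[OF y b(1)]
  note y2 = off_add[OF y1 b(1)]
  show False
  proof (cases "theta (y + b) = theta b")
    case False
    then show False using no_two_negative[OF b y n0] by blast
  next
    case True
    have p2: "theta (y + b + b) \<noteq> theta b" using sign_patterns(1)[OF b y n0 True] .
    have "theta (y + b + b + b) \<noteq> theta b" using sign_patterns(2)[OF b y1 True p2] .
    then show False using no_two_negative[OF b y2 p2] by blast
  qed
qed

text \<open>If \<open>a\<close> is a multiple of \<open>b\<close>, both are compared with some
  \<open>y\<close> outside the multiples of \<open>b\<close>, hence also outside those of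
  \<open>a\<close>.\<close>

lemma theta_const:
  assumes noncyclic: "\<And>b. b \<in> G \<Longrightarrow> \<exists>y\<in>G. \<forall>k::int. y \<noteq> of_int k * b"
    and m: "a \<in> G" "b \<in> G" and nz: "a \<noteq> 0" "b \<noteq> 0"
  shows "theta a = theta b"
proof (cases "off b a")
  case True
  then show ?thesis using theta_eq_off m nz by blast
next
  case False
  then obtain k :: int where k: "a = of_int k * b" using m by (auto simp: off_def)
  obtain y where y: "y \<in> G" "\<forall>k::int. y \<noteq> of_int k * b" using noncyclic[OF m(2)] by blast
  then have "off b y" by (simp add: off_def)
  moreover have "off a y"
    unfolding off_def k using y by (metis mult.assoc of_int_mult)
  ultimately show ?thesis using theta_eq_off m nz by metis
qed

section \<open>Determination of the product and of the form\<close>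

text \<open>With \<open>l x = x / t\<close>, \<open>product_eq\<close> for
  \<open>(-(b + c), b, c)\<close> determines \<open>f b c\<close> except where an entry or the
  factor \<open>2b + c\<close> vanishes. If \<open>1 / t\<close> were in \<open>G\<close>, then
  \<open>s\<close> would vanish at \<open>-1 / t\<close>, contrary to \<open>s_nz\<close>.\<close>

lemma f_eq_V_coeff:
  assumes t: "t \<noteq> 0" "\<And>x. x \<in> G \<Longrightarrow> x \<noteq> 0 \<Longrightarrow> theta x = t"
  shows "inverse t \<notin> G" and "b \<in> G \<Longrightarrow> c \<in> G \<Longrightarrow> f b c = V_coeff 0 t b c"
proof -
  have sx: "s x = x * (1 + t * x)" if "x \<in> G" for x
    using s_eq[of x] t(2)[of x] that by (cases "x = 0") (auto simp: s_def algebra_simps power2_eq_square)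
  have u: "1 + t * x \<noteq> 0" if "x \<in> G" for x
    using s_nz[of x] sx[of x] that by (cases "x = 0") auto
  show "inverse t \<notin> G"
  proof
    assume "inverse t \<in> G"
    then show False using u[of "- inverse t"] t(1) by simp
  qed
  have main: "f b c * (1 + t * (b + c)) = c * (1 + t * c)"
    if m: "b \<in> G" "c \<in> G" and nz: "b \<noteq> 0" "c \<noteq> 0" "b + c \<noteq> 0" and n2: "2 * b + c \<noteq> 0" for b c
  proof -
    have mem: "- (b + c) \<in> G" "- (b + c) \<noteq> 0" using m nz by (auto simp: add_eq_0_iff)
    have "s (b + c) * f b c * (b / t - - (b + c) / t) = (b - - (b + c)) * s c * (b / t + c / t)"
      using product_eq[of "- (b + c)" b c] m nz mem t(2) by (simp add: l_def add.commute)
    then have "(2 * b + c) * (b + c) * (f b c * (1 + t * (b + c)))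
        = (2 * b + c) * (b + c) * (c * (1 + t * c))"
      using t(1) m unfolding sx[OF m(2)] sx[OF add_mem[OF m]] by (simp add: field_simps)
    then show ?thesis using nz n2 by simp
  qed
  have "f b c * (1 + t * (b + c)) = c * (1 + t * c)" if m: "b \<in> G" "c \<in> G" for b c
  proof -
    consider "b = 0" | "c = 0" | "b + c = 0"
      | "b \<noteq> 0" "c \<noteq> 0" "b + c \<noteq> 0" "2 * b + c \<noteq> 0"
      | "b \<noteq> 0" "2 * b + c = 0" by blast
    then show ?thesis
    proof cases
      case 3
      then have "b = - c" by (simp add: add_eq_0_iff2)
      then show ?thesis using sx[OF m(2)] by (simp add: s_def)
    next
      case 4
      then show ?thesis using main m by blast
    next
      case 5
      then have c: "c = - (2 * b)" by (simp add: add_eq_0_iff)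
      \<comment> \<open>For \<open>c = -2b\<close> the opposite product is not degenerate, and
        compatibility gives \<open>f b c\<close> from it.\<close>
      have "f c b * (1 + t * (c + b)) = b * (1 + t * b)"
        using main[of c b] m 5(1) c by simp
      then show ?thesis using comm[OF m] c by algebra
    qed (use m in auto)
  qed
  then show "b \<in> G \<Longrightarrow> c \<in> G \<Longrightarrow> f b c = V_coeff 0 t b c"
    using u[of "b + c"] by (simp add: V_coeff_def eq_divide_eq)
qed

end

section \<open>Free subgroups of rank greater than one\<close>

lemma free_subgroup_closed:
  assumes "free_subgroup_rank G n"
  shows "0 \<in> G" and "a \<in> G \<Longrightarrow> b \<in> G \<Longrightarrow> a + b \<in> G" and "a \<in> G \<Longrightarrow> - a \<in> G"
proof -
  obtain e where G: "G = {(\<Sum>i<n. of_int (k i) * e i) | k :: nat \<Rightarrow> int. True}"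
    using assms unfolding free_subgroup_rank_def by blast
  have mem: "(\<Sum>i<n. of_int (k i) * e i) \<in> G" for k :: "nat \<Rightarrow> int" unfolding G by blast
  show "0 \<in> G" using mem[of "\<lambda>_. 0"] by simp
  show "a + b \<in> G" if ab: "a \<in> G" "b \<in> G"
  proof -
    obtain k k' :: "nat \<Rightarrow> int" where "a = (\<Sum>i<n. of_int (k i) * e i)" "b = (\<Sum>i<n. of_int (k' i) * e i)"
      using ab unfolding G by blast
    then show ?thesis using mem[of "\<lambda>i. k i + k' i"] by (simp add: distrib_right sum.distrib)
  qed
  show "- a \<in> G" if a: "a \<in> G"
  proof -
    obtain k :: "nat \<Rightarrow> int" where "a = (\<Sum>i<n. of_int (k i) * e i)" using a unfolding G by blast
    then show ?thesis using mem[of "\<lambda>i. - k i"] by (simp add: sum_negf)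
  qed
qed

text \<open>If \<open>e 0 = p b\<close> and \<open>e 1 = q b\<close>, then
  \<open>q e 0 - p e 1 = 0\<close>; independence gives \<open>p = 0\<close>, so
  \<open>e 0 = 0\<close>, which independence forbids.\<close>

lemma free_subgroup_noncyclic:
  assumes "free_subgroup_rank G n" "n > 1"
  shows "\<exists>y\<in>G. \<forall>k::int. y \<noteq> of_int k * b"
proof (rule ccontr)
  assume "\<not> ?thesis"
  then have cyc: "\<exists>k::int. y = of_int k * b" if "y \<in> G" for y using that by blast
  obtain e :: "nat \<Rightarrow> complex" where
    ind: "\<And>k :: nat \<Rightarrow> int. (\<Sum>i<n. of_int (k i) * e i) = 0 \<Longrightarrow> \<forall>i<n. k i = 0"
    and G: "G = {(\<Sum>i<n. of_int (k i) * e i) | k :: nat \<Rightarrow> int. True}"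
    using assms(1) unfolding free_subgroup_rank_def by blast
  have comb: "(\<Sum>i<n. of_int (((\<lambda>_. 0)(0 := p, 1 := q)) i) * e i) = of_int p * e 0 + of_int q * e 1"
    for p q :: int
  proof -
    have "(\<Sum>i<n. of_int (((\<lambda>_. 0)(0 := p, 1 := q)) i) * e i)
        = (\<Sum>i\<in>{0, 1}. of_int (((\<lambda>_. 0)(0 := p, 1 := q)) i) * e i)"
      using assms(2) by (intro sum.mono_neutral_right) auto
    then show ?thesis by simp
  qed
  have mem: "of_int p * e 0 + of_int q * e 1 \<in> G" for p q
    unfolding G comb[symmetric] by blast
  have ind2: "p = 0 \<and> q = 0" if "of_int p * e 0 + of_int q * e 1 = 0" for p q :: int
  proof -
    have "\<forall>i<n. ((\<lambda>_. 0)(0 := p, 1 := q)) i = 0"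
      by (rule ind) (simp only: comb that)
    then show ?thesis using assms(2) by (metis fun_upd_apply less_trans zero_less_one zero_neq_one)
  qed
  obtain p where p: "e 0 = of_int p * b" using cyc[OF mem[of 1 0]] by auto
  obtain q where q: "e 1 = of_int q * b" using cyc[OF mem[of 0 1]] by auto
  have "of_int q * e 0 + of_int (- p) * e 1 = 0" unfolding p q by simp
  then have "p = 0" using ind2[of q "- p"] by simp
  then have "e 0 = 0" using p by simp
  then show False using ind2[of 1 0] by simp
qed

section \<open>Extension forms and cocycles\<close>

lemma witt_lsaI:
  assumes "free_subgroup_rank G n" "graded_CLSAS G f"
  shows "witt_lsa G f"
  using free_subgroup_closed[OF assms(1)] assms(2)
  unfolding graded_CLSAS_def by unfold_locales blast+

context witt_lsa
begin

text \<open>For \<open>a + b + c = 0\<close> condition (i) involves only the pairs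
  \<open>(L_(-x), L_x)\<close>, so the degree-zero part of the form satisfies a closed
  system.\<close>

lemma form_cocycle:
  assumes "virasoro_ext_form G f \<psi>"
  shows "cocycle (\<lambda>x. \<psi> (- x) x)" and "virasoro_odd (\<lambda>x. \<psi> (- x) x)"
proof -
  show "cocycle (\<lambda>x. \<psi> (- x) x)"
    unfolding cocycle_def
  proof (intro ballI impI)
    fix a b c assume m: "a \<in> G" "b \<in> G" "c \<in> G" and e: "a + b + c = 0"
    have q: "b + c = - a" "a + c = - b" "a + b = - c" "b + a = - c" using e by algebra+
    have "f a b * \<psi> (a + b) c - f b c * \<psi> a (b + c) = f b a * \<psi> (b + a) c - f a c * \<psi> b (a + c)"
      using assms m unfolding virasoro_ext_form_def by blast
    then have "\<psi> a (- a) * f b c - \<psi> b (- b) * f a c = (f a b - f b a) * \<psi> (- c) c"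
      unfolding q by algebra
    then show "\<psi> (- (- a)) (- a) * f b c - \<psi> (- (- b)) (- b) * f a c = (b - a) * \<psi> (- c) c"
      using comm[OF m(1,2)] by simp
  qed
  show "virasoro_odd (\<lambda>x. \<psi> (- x) x)"
    unfolding virasoro_odd_def
  proof
    fix x assume "x \<in> G"
    then have "\<psi> (- x) x - \<psi> x (- x) = (x ^ 3 - x) / 12 * kdelta (- x + x) 0"
      using assms uminus_mem unfolding virasoro_ext_form_def by blast
    then show "\<psi> (- x) x - \<psi> (- (- x)) (- x) = (x ^ 3 - x) / 12" by (simp add: kdelta_def)
  qed
qed

lemma form_virasoro_lsa:
  assumes "virasoro_ext_form G f \<psi>" "w \<in> G" "w \<noteq> 0"
  shows "virasoro_lsa G f (\<lambda>x. \<psi> (- x) x)"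
  using form_cocycle[OF assms(1)] right_zero[OF form_cocycle[OF assms(1)] assms(2,3)]
  by unfold_locales auto

end

text \<open>For \<open>a + b + c = 0\<close> the denominator of \<open>f b c\<close> is
  \<open>1 - t a\<close>, which is a factor of \<open>h (-a)\<close>. After cancellation, condition
  (i) is a polynomial identity that comes down to
  \<open>(b - a) (c - t) = (a - b) (a + b + t)\<close>.\<close>

lemma V_coeff_form:
  assumes "witt_lsa G f" and t: "t \<noteq> 0" "inverse t \<notin> G"
    and f: "\<forall>b\<in>G. \<forall>c\<in>G. f b c = V_coeff 0 t b c"
  shows "virasoro_ext_form G f
    (\<lambda>a b. (b ^ 3 - b - (t - inverse t) * b ^ 2) / 24 * kdelta (a + b) 0)"
proof -
  interpret witt_lsa G f by fact
  define h where "h b = (b ^ 3 - b - (t - inverse t) * b ^ 2) / 24" for b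
  have u: "1 + t * x \<noteq> 0" if "x \<in> G" for x
  proof
    assume "1 + t * x = 0"
    then have "inverse t = - x" using t(1) by (simp add: field_simps add_eq_0_iff)
    then show False using t(2) that by simp
  qed
  have h_alt: "h b = b * (b - t) * (1 + t * b) / (24 * t)" for b
    unfolding h_def using t(1) by (simp add: field_simps power2_eq_square power3_eq_cube)
  have fh: "f b c * h (- a) = c * (1 + t * c) * a * (a + t) / (24 * t)"
    if m: "a \<in> G" "b \<in> G" "c \<in> G" and e: "a + b + c = 0" for a b c
  proof -
    have "b + c = - a" using e by algebra
    then have "f b c * (1 + t * - a) = c * (1 + t * c)"
      using f m u[of "- a"] by (simp add: V_coeff_def)
    moreover have "24 * t * h (- a) = - a * (- a - t) * (1 + t * - a)"
      using t(1) unfolding h_alt by simp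
    ultimately have "24 * t * (f b c * h (- a)) = c * (1 + t * c) * a * (a + t)" by algebra
    then show ?thesis using t(1) by (simp add: eq_divide_eq mult.commute)
  qed
  show ?thesis
    unfolding virasoro_ext_form_def h_def[symmetric]
  proof (intro conjI ballI)
    fix a b c assume m: "a \<in> G" "b \<in> G" "c \<in> G"
    show "f a b * (h c * kdelta (a + b + c) 0) - f b c * (h (b + c) * kdelta (a + (b + c)) 0)
        = f b a * (h c * kdelta (b + a + c) 0) - f a c * (h (a + c) * kdelta (b + (a + c)) 0)"
    proof (cases "a + b + c = 0")
      case True
      have q: "b + c = - a" "a + c = - b" using True by algebra+
      have e: "b + a + c = 0" using True by (simp add: algebra_simps)
      have d: "kdelta (a + b + c) 0 = 1" "kdelta (a + (b + c)) 0 = 1" "kdelta (b + a + c) 0 = 1"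
        "kdelta (b + (a + c)) 0 = 1"
        using True by (simp_all add: kdelta_def algebra_simps)
      have "(b - a) * (c * (c - t) * (1 + t * c))
          = c * (1 + t * c) * a * (a + t) - c * (1 + t * c) * b * (b + t)"
        using True by algebra
      then have "(b - a) * h c = f b c * h (- a) - f a c * h (- b)"
        unfolding fh[OF m True] fh[OF m(2,1,3) e] h_alt[of c]
        by (simp only: times_divide_eq_right diff_divide_distrib[symmetric])
      then have "f a b * h c - f b c * h (- a) = f b a * h c - f a c * h (- b)"
        using comm[OF m(1,2)] by algebra
      then show ?thesis unfolding d q by (simp add: kdelta_def)
    next
      case False
      then have "a + (b + c) \<noteq> 0" "b + a + c \<noteq> 0" "b + (a + c) \<noteq> 0" by (auto simp: algebra_simps)
      then show ?thesis using False by (simp add: kdelta_def)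
    qed
  next
    fix a b assume "a \<in> G" "b \<in> G"
    show "h b * kdelta (a + b) 0 - h a * kdelta (b + a) 0 = (b ^ 3 - b) / 12 * kdelta (a + b) 0"
    proof (cases "a + b = 0")
      case True
      then have "a = - b" by (simp add: add_eq_0_iff2)
      then show ?thesis by (simp add: kdelta_def h_def field_simps)
    next
      case False
      then show ?thesis by (simp add: kdelta_def add.commute)
    qed
  qed
qed

text \<open>In nonzero degree the action of \<open>L_0\<close> expresses the form through
  \<open>\<psi> 0 (a + b)\<close>, which vanishes. In degree zero \<open>h_eq\<close> gives the
  values at nonzero \<open>b\<close>, and the cocycle equation for \<open>(0, -w, w)\<close> gives
  \<open>\<psi> 0 0 = 0\<close>.\<close>

lemma form_unique:
  assumes "witt_lsa G f" and w: "w \<in> G" "w \<noteq> 0" and t: "t \<noteq> 0"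
    and f: "\<forall>b\<in>G. \<forall>c\<in>G. f b c = V_coeff 0 t b c"
    and form: "virasoro_ext_form G f \<psi>" and m: "a \<in> G" "b \<in> G"
  shows "\<psi> a b = (b ^ 3 - b - (t - inverse t) * b ^ 2) / 24 * kdelta (a + b) 0"
proof -
  interpret witt_lsa G f by fact
  interpret virasoro_lsa G f "\<lambda>x. \<psi> (- x) x" using form_virasoro_lsa[OF form w] .
  have first: "(x + y) * \<psi> x y = f x y * \<psi> 0 (x + y)" if "x \<in> G" "y \<in> G" for x y
  proof -
    have "f 0 x * \<psi> (0 + x) y - f x y * \<psi> 0 (x + y) = f x 0 * \<psi> (x + 0) y - f 0 y * \<psi> x (0 + y)"
      using form that zero_mem unfolding virasoro_ext_form_def by blast
    then show ?thesis using that by (simp add: algebra_simps)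
  qed
  have odd: "\<psi> x y - \<psi> y x = (y ^ 3 - y) / 12 * kdelta (x + y) 0" if "x \<in> G" "y \<in> G" for x y
    using form that unfolding virasoro_ext_form_def by blast
  show ?thesis
  proof (cases "a + b = 0")
    case False
    have "\<psi> 0 (a + b) = \<psi> (a + b) 0"
      \<comment> \<open>Outside degree zero condition (ii) makes the form symmetric.\<close>
      using odd[of 0 "a + b"] False m by (simp add: kdelta_def)
    moreover have "\<psi> (a + b) 0 = 0" using first[of "a + b" 0] False m by simp
    ultimately have "\<psi> a b = 0" using first[OF m] False by simp
    then show ?thesis using False by (simp add: kdelta_def)
  next
    case True
    then have a: "a = - b" by (simp add: add_eq_0_iff2)
    show ?thesis
    proof (cases "b = 0")
      case False
      have sb: "s b = b * (1 + t * b)" using f m by (simp add: s_def V_coeff_def)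
      then have "theta b = t" using False by (simp add: theta_def field_simps power2_eq_square)
      then have "24 * t * \<psi> (- b) b = b * (1 + t * b) * (b - t)"
        using h_eq[OF m(2) False] sb by simp
      then show ?thesis using t unfolding a
        by (simp add: kdelta_def field_simps power2_eq_square power3_eq_cube)
    next
      case True
      have "s w * \<psi> 0 0 = 0"
        using cocycleD[OF h_cocycle, of 0 "- w" w] w by (simp add: s_def algebra_simps)
      then have "\<psi> 0 0 = 0" using s_nz[OF w] by simp
      then show ?thesis using True a by simp
    qed
  qed
qed

theorem theorem5p1:
  fixes G :: "complex set" and \<nu> :: nat and f :: "complex \<Rightarrow> complex \<Rightarrow> complex"
  assumes "free_subgroup_rank G \<nu>" and "\<nu> > 1"
    and "graded_CLSAS G f"
  shows "((\<exists>\<psi>. virasoro_ext_form G f \<psi>) \<longleftrightarrow>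
           (\<exists>\<theta>. \<theta> \<noteq> 0 \<and> inverse \<theta> \<notin> G \<and> (\<forall>b\<in>G. \<forall>c\<in>G. f b c = V_coeff 0 \<theta> b c))) \<and>
         (\<forall>\<theta> \<psi>. \<theta> \<noteq> 0 \<and> inverse \<theta> \<notin> G \<and> (\<forall>b\<in>G. \<forall>c\<in>G. f b c = V_coeff 0 \<theta> b c) \<and>
                 virasoro_ext_form G f \<psi> \<longrightarrow>
            (\<forall>a\<in>G. \<forall>b\<in>G. \<psi> a b =
               (b ^ 3 - b - (\<theta> - inverse \<theta>) * b ^ 2) / 24 * kdelta (a + b) 0))"
proof -
  have lsa: "witt_lsa G f" using witt_lsaI assms by blast
  note noncyclic = free_subgroup_noncyclic[OF assms(1,2)]
  \<comment> \<open>The multiples of 0 are just 0, so an element outside them is nonzero.\<close>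
  obtain w where w: "w \<in> G" "w \<noteq> 0" using noncyclic[of 0] by auto
  have "\<exists>\<theta>. \<theta> \<noteq> 0 \<and> inverse \<theta> \<notin> G \<and> (\<forall>b\<in>G. \<forall>c\<in>G. f b c = V_coeff 0 \<theta> b c)"
    if form: "virasoro_ext_form G f \<psi>" for \<psi>
  proof -
    interpret virasoro_lsa G f "\<lambda>x. \<psi> (- x) x"
      using witt_lsa.form_virasoro_lsa[OF lsa form w] .
    have "theta x = theta w" if "x \<in> G" "x \<noteq> 0" for x
      using theta_const noncyclic that w by blast
    then show ?thesis using f_eq_V_coeff[of "theta w"] theta_nz[OF w] by blast
  qed
  moreover have "\<exists>\<psi>. virasoro_ext_form G f \<psi>"
    if "\<theta> \<noteq> 0" "inverse \<theta> \<notin> G" "\<forall>b\<in>G. \<forall>c\<in>G. f b c = V_coeff 0 \<theta> b c" for \<theta>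
    using V_coeff_form[OF lsa that] by blast
  ultimately show ?thesis using form_unique[OF lsa w] by blast
qed

end
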